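(* Let $p_n$ denote the proportion of realizable edge-degeneracy vectors (elements of the finite set $\{(E(G),\mathrm{degen}(G)) : G\in\mathcal{G}_n\}$) that lie in the relative interior of $\mathcal{P}_n$. Then $$\lim_{n\to\infty}p_n=1.$$
   Context: $\mathcal{G}_n$ is the set of labeled, undirected simple graphs on $n$ vertices; $E(G)$ is the number of edges of $G$. The $k$-core of $G$ is its maximal subgraph with minimum degree at least $k$; $\mathrm{degen}(G)$ is the maximum $k$ for which the $k$-core of $G$ is non-empty. The model polytope is $\mathcal{P}_n=\mathrm{conv}\{(E(G),\mathrm{degen}(G)) : G\in\mathcal{G}_n\}\subset\mathbb{R}^2$. The proportion counts distinct vectors, not graphs. *)

theory Defs
  imports "HOL-Analysis.Analysis"
begin

text \<open>
  A graph is a pair of a vertex set and a set of edges, an undirected edge being the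
  two-element set of its end points.
\<close>

type_synonym 'a ugraph = "'a set \<times> 'a set set"

abbreviation verts :: "'a ugraph \<Rightarrow> 'a set" where
  "verts G \<equiv> fst G"

abbreviation edges :: "'a ugraph \<Rightarrow> 'a set set" where
  "edges G \<equiv> snd G"

definition simple_graph :: "'a ugraph \<Rightarrow> bool" where
  "simple_graph G \<longleftrightarrow> finite (verts G) \<and> (\<forall>e\<in>edges G. e \<subseteq> verts G \<and> card e = 2)"

definition labeled_graphs :: "nat \<Rightarrow> nat ugraph set" where
  "labeled_graphs n = {G. simple_graph G \<and> verts G = {1..n}}"

definition num_edges :: "'a ugraph \<Rightarrow> nat" where
  "num_edges G = card (edges G)"

definition degree :: "'a ugraph \<Rightarrow> 'a \<Rightarrow> nat" where
  "degree G v = card {e \<in> edges G. v \<in> e}"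

definition subgraph :: "'a ugraph \<Rightarrow> 'a ugraph \<Rightarrow> bool" where
  "subgraph H G \<longleftrightarrow> simple_graph H \<and> verts H \<subseteq> verts G \<and> edges H \<subseteq> edges G"

text \<open>
  The graph without vertices satisfies this vacuously for every \<open>k\<close>; hence every finite
  simple graph has a \<open>k\<close>-core, which may be empty.
\<close>

definition min_degree_ge :: "nat \<Rightarrow> 'a ugraph \<Rightarrow> bool" where
  "min_degree_ge k H \<longleftrightarrow> (\<forall>v\<in>verts H. k \<le> degree H v)"

definition is_core :: "nat \<Rightarrow> 'a ugraph \<Rightarrow> 'a ugraph \<Rightarrow> bool" where
  "is_core k G H \<longleftrightarrow>
     subgraph H G \<and> min_degree_ge k H \<and>
     (\<forall>H'. subgraph H' G \<and> min_degree_ge k H' \<and> subgraph H H' \<longrightarrow> H' = H)"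

text \<open>
  For a finite simple graph with at least one vertex the set below is finite and contains
  \<open>0\<close>. For the graph without vertices it is empty and the value is unspecified.
\<close>

definition degen :: "'a ugraph \<Rightarrow> nat" where
  "degen G = Max {k. \<exists>H. is_core k G H \<and> verts H \<noteq> {}}"

definition realizable_vectors :: "nat \<Rightarrow> (real \<times> real) set" where
  "realizable_vectors n = (\<lambda>G. (real (num_edges G), real (degen G))) ` labeled_graphs n"

definition model_polytope :: "nat \<Rightarrow> (real \<times> real) set" where
  "model_polytope n = convex hull (realizable_vectors n)"

definition interior_proportion :: "nat \<Rightarrow> real" where
  "interior_proportion n =
     real (card (realizable_vectors n \<inter> rel_interior (model_polytope n))) /
     real (card (realizable_vectors n))"

end

theory Submission imports Defs "HOL-Real_Asymp.Real_Asymp" begin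

text \<open>
  Arrange the realizable vectors in horizontal rows, one row for each value of the
  degeneracy. Consider a vector that has a realizable vector to its left and another to its
  right in its own row, and realizable vectors in rows below and above it. It lies in the
  relative interior of the hull: a linear functional that is minimal there is constant along
  the row, so it depends on the height only, and a non-constant linear function of the
  height is not minimal at an intermediate height (\<open>in_rel_interior_if_surrounded\<close>).

  The lowest row belongs to degeneracy \<open>0\<close> and consists of the edgeless graph's vector alone;
  the highest row belongs to degeneracy \<open>n - 1\<close> and consists of the complete graph's vector
  alone. Hence at most the two ends of each row fail to be in the relative interior, which
  makes at most \<open>2n\<close> vectors. On the other hand, every number of edges from \<open>0\<close> to
  \<open>n choose 2\<close> occurs, so there are quadratically many realizable vectors already for
  this reason, whatever degeneracies occur with a given number of edges. The proportion of
  the exceptions is therefore at most \<open>4 / (n - 1)\<close>.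
\<close>

section \<open>Finite planar sets and the relative interior of their hull\<close>

lemma in_rel_interior_if_surrounded:
  fixes S :: "(real \<times> real) set"
  assumes S: "convex S" and p: "p \<in> S"
    and a: "a \<in> S" "snd a = snd p" "fst a < fst p"
    and b: "b \<in> S" "snd b = snd p" "fst p < fst b"
    and q: "q \<in> S" "snd q < snd p"
    and r: "r \<in> S" "snd p < snd r"
  shows "p \<in> rel_interior S"
proof (rule ccontr)
  assume "p \<notin> rel_interior S"
  then obtain c where c: "c \<noteq> 0" "\<And>y. y \<in> S \<Longrightarrow> c \<bullet> p \<le> c \<bullet> y"
    using supporting_hyperplane_rel_boundary[OF S p] by metis
  have ip: "c \<bullet> y = fst c * fst y + snd c * snd y" for y
    by (simp add: inner_prod_def)
  have "fst c * (fst p - fst a) \<le> 0" "0 \<le> fst c * (fst b - fst p)"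
    using c(2)[OF a(1)] c(2)[OF b(1)] a b by (simp_all add: ip algebra_simps)
  then have "fst c = 0"
    using a(3) b(3) by (auto simp: mult_le_0_iff zero_le_mult_iff)
  moreover from this have "snd c * (snd p - snd q) \<le> 0" "0 \<le> snd c * (snd r - snd p)"
    using c(2)[OF q(1)] c(2)[OF r(1)] by (simp_all add: ip algebra_simps)
  then have "snd c = 0"
    using q(2) r(2) by (auto simp: mult_le_0_iff zero_le_mult_iff)
  ultimately show False
    using c(1) by (simp add: prod_eq_iff)
qed

text \<open>
  Inside a row, only the two ends can be exceptions. This argument needs rows below and above,
  and indeed the lowest and the highest of several rows lie entirely on the relative boundary.
  The hypothesis on \<open>q\<close> and \<open>r\<close> keeps these rows so short that they consist of their ends.
\<close>

lemma card_diff_rel_interior_convex_hull_le: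
  fixes R :: "(real \<times> real) set"
  assumes fin: "finite R" and q: "q \<in> R" and r: "r \<in> R"
    and between: "\<And>p. p \<in> R \<Longrightarrow> p = q \<or> p = r \<or> snd q < snd p \<and> snd p < snd r"
  shows "card (R - rel_interior (convex hull R)) \<le> 2 * card (snd ` R)"
proof -
  define A where "A = {p \<in> R. \<forall>a\<in>R. snd a = snd p \<longrightarrow> fst p \<le> fst a}"
  define B where "B = {p \<in> R. \<forall>b\<in>R. snd b = snd p \<longrightarrow> fst b \<le> fst p}"
  have sub: "R - rel_interior (convex hull R) \<subseteq> A \<union> B"
  proof (rule subsetI, rule ccontr)
    fix p assume p: "p \<in> R - rel_interior (convex hull R)" and "p \<notin> A \<union> B"
    then obtain a b where a: "a \<in> R" "snd a = snd p" "fst a < fst p"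
      and b: "b \<in> R" "snd b = snd p" "fst p < fst b"
      unfolding A_def B_def by force
    \<comment> \<open>The rows of \<open>q\<close> and \<open>r\<close> contain no other points, too few for \<open>a\<close>, \<open>p\<close> and \<open>b\<close>.\<close>
    have "snd q < snd p \<and> snd p < snd r"
      using between[of p] between[OF a(1)] between[OF b(1)] p a b by auto
    then have "p \<in> rel_interior (convex hull R)"
      using p a b q r
      by (intro in_rel_interior_if_surrounded[of _ p a b q r]) (auto simp: hull_inc)
    with p show False by blast
  qed
  have "inj_on snd A" "inj_on snd B"
    unfolding A_def B_def by (auto intro!: inj_onI prod_eqI antisym)
  then have "card A \<le> card (snd ` R)" "card B \<le> card (snd ` R)"
    using fin by (auto intro!: card_inj_on_le simp: A_def B_def)
  moreover have "card (R - rel_interior (convex hull R)) \<le> card (A \<union> B)"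
    using fin by (intro card_mono sub) (auto simp: A_def B_def)
  ultimately show ?thesis
    using card_Un_le[of A B] by linarith
qed

section \<open>Degrees and cores\<close>

definition all_pairs :: "'a set \<Rightarrow> 'a set set" where
  "all_pairs V = {e. e \<subseteq> V \<and> card e = 2}"

lemma finite_all_pairs: "finite V \<Longrightarrow> finite (all_pairs V)"
  by (simp add: all_pairs_def)

lemma card_all_pairs: "finite V \<Longrightarrow> card (all_pairs V) = card V choose 2"
  by (simp add: all_pairs_def n_subsets)

lemma simple_graph_iff: "simple_graph G \<longleftrightarrow> finite (verts G) \<and> edges G \<subseteq> all_pairs (verts G)"
  by (auto simp: simple_graph_def all_pairs_def)

lemma subgraph_refl: "simple_graph G \<Longrightarrow> subgraph G G"
  by (simp add: subgraph_def)

lemma incident_pairs_eq_image: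
  assumes "v \<in> V"
  shows "{e \<in> all_pairs V. v \<in> e} = (\<lambda>w. {v, w}) ` (V - {v})"
proof (intro equalityI subsetI)
  fix e assume "e \<in> {e \<in> all_pairs V. v \<in> e}"
  then have e: "e \<subseteq> V" "card e = 2" "v \<in> e"
    by (simp_all add: all_pairs_def)
  then obtain w where "e = {v, w}" "v \<noteq> w"
    by (metis card_2_iff doubleton_eq_iff insertE singletonD)
  with e show "e \<in> (\<lambda>w. {v, w}) ` (V - {v})"
    by blast
next
  fix e assume "e \<in> (\<lambda>w. {v, w}) ` (V - {v})"
  with assms show "e \<in> {e \<in> all_pairs V. v \<in> e}"
    by (auto simp: all_pairs_def)
qed

lemma card_incident_pairs:
  assumes "finite V" "v \<in> V"
  shows "card {e \<in> all_pairs V. v \<in> e} = card V - 1"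
proof -
  have "inj_on (\<lambda>w. {v, w}) (V - {v})"
    by (auto simp: inj_on_def doubleton_eq_iff)
  then show ?thesis
    using assms by (simp add: incident_pairs_eq_image card_image)
qed

lemma degree_le:
  assumes "simple_graph G" "v \<in> verts G"
  shows "degree G v \<le> card (verts G) - 1"
proof -
  have "degree G v \<le> card {e \<in> all_pairs (verts G). v \<in> e}"
    unfolding degree_def using assms
    by (intro card_mono) (auto simp: simple_graph_iff finite_all_pairs)
  then show ?thesis
    using assms by (simp add: card_incident_pairs simple_graph_iff)
qed

lemma edges_eq_all_pairs_if_min_degree_ge:
  assumes G: "simple_graph G" and deg: "min_degree_ge (card (verts G) - 1) G"
  shows "edges G = all_pairs (verts G)"
proof
  show "edges G \<subseteq> all_pairs (verts G)"
    using G by (simp add: simple_graph_iff)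
  show "all_pairs (verts G) \<subseteq> edges G"
  proof
    fix e assume e: "e \<in> all_pairs (verts G)"
    then obtain v where v: "v \<in> e" "v \<in> verts G"
      by (auto simp: all_pairs_def card_2_iff)
    have "{e \<in> edges G. v \<in> e} = {e \<in> all_pairs (verts G). v \<in> e}"
    proof (rule card_seteq)
      show "card {e \<in> all_pairs (verts G). v \<in> e} \<le> card {e \<in> edges G. v \<in> e}"
        using G deg v by (simp add: card_incident_pairs simple_graph_iff min_degree_ge_def degree_def)
    qed (use G in \<open>auto simp: simple_graph_iff finite_all_pairs\<close>)
    with e v show "e \<in> edges G" by blast
  qed
qed

lemma finite_subgraphs:
  assumes "simple_graph G"
  shows "finite {H. subgraph H G}"
proof (rule finite_subset)
  show "{H. subgraph H G} \<subseteq> Pow (verts G) \<times> Pow (edges G)"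
    by (auto simp: subgraph_def)
  show "finite (Pow (verts G) \<times> Pow (edges G))"
    using assms by (auto simp: simple_graph_iff dest: finite_subset[OF _ finite_all_pairs])
qed

text \<open>
  Cores are defined by maximality only. A subgraph of the largest size among those of minimum
  degree at least \<open>k\<close> that contain \<open>H\<close> is maximal.
\<close>

lemma exists_core_above:
  assumes G: "simple_graph G" and H: "subgraph H G" "min_degree_ge k H"
  shows "\<exists>K. is_core k G K \<and> subgraph H K"
proof -
  define P where "P = {K. subgraph K G \<and> min_degree_ge k K \<and> subgraph H K}"
  define size where "size K = card (verts K) + card (edges K)" for K :: "'a ugraph"
  have "finite P"
    using finite_subgraphs[OF G] by (rule rev_finite_subset) (auto simp: P_def)
  moreover have HP: "H \<in> P"
    using H by (auto simp: P_def subgraph_def)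
  ultimately have "Max (size ` P) \<in> size ` P"
    by (intro Max_in) auto
  then obtain K where K: "K \<in> P" "size K = Max (size ` P)"
    by auto
  have max: "size K' \<le> size K" if "K' \<in> P" for K'
    using that K \<open>finite P\<close> by simp
  have "K' = K" if K': "subgraph K' G" "min_degree_ge k K'" "subgraph K K'" for K'
  proof -
    have sub: "verts K \<subseteq> verts K'" "edges K \<subseteq> edges K'"
      using K' by (auto simp: subgraph_def)
    have fin: "finite (verts K')" "finite (edges K')"
      using K' by (auto simp: subgraph_def simple_graph_iff dest: finite_subset[OF _ finite_all_pairs])
    have "K' \<in> P"
      using K(1) K' by (auto simp: P_def subgraph_def)
    then have "card (verts K') + card (edges K') \<le> card (verts K) + card (edges K)"
      using max by (simp add: size_def)
    moreover have "card (verts K) \<le> card (verts K')" "card (edges K) \<le> card (edges K')"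
      using sub fin by (auto intro: card_mono)
    ultimately have "card (verts K') \<le> card (verts K)" "card (edges K') \<le> card (edges K)"
      by linarith+
    then have "verts K = verts K'" "edges K = edges K'"
      using card_seteq[OF fin(1) sub(1)] card_seteq[OF fin(2) sub(2)] by simp_all
    then show ?thesis by (simp add: prod_eq_iff)
  qed
  with K show ?thesis
    unfolding is_core_def P_def by blast
qed

section \<open>Degeneracy\<close>

lemma core_index_le:
  assumes G: "simple_graph G" and H: "is_core k G H" "verts H \<noteq> {}"
  shows "k \<le> card (verts H) - 1" "card (verts H) \<le> card (verts G)"
proof -
  obtain v where "v \<in> verts H" using H by blast
  then show "k \<le> card (verts H) - 1"
    using H degree_le[of H v] by (force simp: is_core_def subgraph_def min_degree_ge_def)
  show "card (verts H) \<le> card (verts G)"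
    using G H by (auto simp: is_core_def subgraph_def simple_graph_def intro: card_mono)
qed

lemma finite_core_indices:
  assumes "simple_graph G"
  shows "finite {k. \<exists>H. is_core k G H \<and> verts H \<noteq> {}}"
proof (rule finite_subset)
  show "{k. \<exists>H. is_core k G H \<and> verts H \<noteq> {}} \<subseteq> {..card (verts G)}"
  proof
    fix k assume "k \<in> {k. \<exists>H. is_core k G H \<and> verts H \<noteq> {}}"
    then obtain H where "is_core k G H" "verts H \<noteq> {}"
      by blast
    from core_index_le[OF assms this] show "k \<in> {..card (verts G)}"
      by simp
  qed
qed simp

lemma degen_core:
  assumes G: "simple_graph G" and ne: "verts G \<noteq> {}"
  shows "\<exists>H. is_core (degen G) G H \<and> verts H \<noteq> {}"
proof -
  obtain K where "is_core 0 G K" "subgraph G K"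
    using exists_core_above[OF G subgraph_refl[OF G], of 0] by (auto simp: min_degree_ge_def)
  moreover from this ne have "verts K \<noteq> {}"
    by (auto simp: subgraph_def)
  ultimately have "\<exists>H. is_core 0 G H \<and> verts H \<noteq> {}"
    by blast
  then have "degen G \<in> {k. \<exists>H. is_core k G H \<and> verts H \<noteq> {}}"
    unfolding degen_def using finite_core_indices[OF G] by (intro Max_in) auto
  then show ?thesis by simp
qed

lemma degen_le:
  assumes "simple_graph G" "verts G \<noteq> {}"
  shows "degen G \<le> card (verts G) - 1"
proof -
  obtain H where "is_core (degen G) G H" "verts H \<noteq> {}"
    using degen_core[OF assms] by blast
  from core_index_le[OF assms(1) this] show ?thesis
    by simp
qed

text \<open>
  The subgraph \<open>H\<close> is the usual certificate for a lower bound on the degeneracy; it need not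
  be a core itself.
\<close>

lemma le_degen:
  assumes G: "simple_graph G" and H: "subgraph H G" "min_degree_ge k H" "verts H \<noteq> {}"
  shows "k \<le> degen G"
proof -
  obtain K where K: "is_core k G K" "subgraph H K"
    using exists_core_above[OF G H(1,2)] by blast
  with H(3) have "verts K \<noteq> {}"
    by (auto simp: subgraph_def)
  with K have "k \<in> {k. \<exists>H. is_core k G H \<and> verts H \<noteq> {}}"
    by blast
  then show ?thesis
    unfolding degen_def using finite_core_indices[OF G] by (intro Max_ge)
qed

lemma degen_eq_0_iff:
  assumes G: "simple_graph G" and ne: "verts G \<noteq> {}"
  shows "degen G = 0 \<longleftrightarrow> edges G = {}"
proof
  assume d: "degen G = 0"
  show "edges G = {}"
  proof (rule ccontr)
    assume "edges G \<noteq> {}"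
    then obtain e where e: "e \<in> edges G" by blast
    then have e2: "e \<subseteq> verts G" "card e = 2"
      using G by (auto simp: simple_graph_def)
    \<comment> \<open>A single edge with its end points has minimum degree 1.\<close>
    have "subgraph (e, {e}) G" "min_degree_ge 1 (e, {e})" "e \<noteq> {}"
      using G e e2
      by (auto simp: subgraph_def simple_graph_def min_degree_ge_def degree_def
          card_gt_0_iff Suc_le_eq intro: finite_subset)
    with le_degen[OF G, of "(e, {e})" 1] d show False by simp
  qed
next
  assume e: "edges G = {}"
  obtain H where H: "is_core (degen G) G H" "verts H \<noteq> {}"
    using degen_core[OF G ne] by blast
  then have "edges H = {}" using e by (auto simp: is_core_def subgraph_def)
  with H show "degen G = 0"
    by (auto simp: is_core_def min_degree_ge_def degree_def)
qed

text \<open>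
  A non-empty core of minimum degree \<open>card (verts G) - 1\<close> must use every vertex of the graph and join it
  to all others.
\<close>

lemma degen_eq_card_verts_minus_1_iff:
  assumes G: "simple_graph G" and ne: "verts G \<noteq> {}"
  shows "degen G = card (verts G) - 1 \<longleftrightarrow> edges G = all_pairs (verts G)"
proof
  assume d: "degen G = card (verts G) - 1"
  obtain H where H: "is_core (degen G) G H" "verts H \<noteq> {}"
    using degen_core[OF G ne] by blast
  have fin: "finite (verts G)" using G by (simp add: simple_graph_def)
  have HG: "subgraph H G" using H by (simp add: is_core_def)
  then have sub: "verts H \<subseteq> verts G" by (simp add: subgraph_def)
  have "0 < card (verts H)"
    using H sub fin by (auto simp: card_gt_0_iff intro: finite_subset)
  then have "card (verts G) \<le> card (verts H)"
    using core_index_le[OF G H] d by linarith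
  then have eq: "verts H = verts G"
    using sub fin by (intro card_seteq)
  then have "edges H = all_pairs (verts G)"
    using edges_eq_all_pairs_if_min_degree_ge[of H] H d HG by (simp add: is_core_def subgraph_def)
  then show "edges G = all_pairs (verts G)"
    using HG G by (auto simp: subgraph_def simple_graph_iff)
next
  assume e: "edges G = all_pairs (verts G)"
  have "min_degree_ge (card (verts G) - 1) G"
    using G e by (simp add: min_degree_ge_def degree_def card_incident_pairs simple_graph_iff)
  then have "card (verts G) - 1 \<le> degen G"
    using le_degen[OF G subgraph_refl[OF G]] ne by blast
  with degen_le[OF G ne] show "degen G = card (verts G) - 1" by simp
qed

section \<open>Realizable vectors\<close>

lemma labeled_graphs_eq: "labeled_graphs n = {{1..n}} \<times> Pow (all_pairs {1..n})"
  by (auto simp: labeled_graphs_def simple_graph_iff)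

lemma finite_realizable_vectors: "finite (realizable_vectors n)"
  by (simp add: realizable_vectors_def labeled_graphs_eq finite_all_pairs)

lemma realizable_vectorsI:
  assumes "E \<subseteq> all_pairs {1..n}"
  shows "(real (card E), real (degen ({1..n}, E))) \<in> realizable_vectors n"
proof -
  have "({1..n}, E) \<in> labeled_graphs n"
    using assms by (simp add: labeled_graphs_eq)
  then show ?thesis
    unfolding realizable_vectors_def by (rule rev_image_eqI) (simp add: num_edges_def)
qed

text \<open>Counting the values of the first coordinate avoids determining which degeneracies
  occur with them.\<close>

lemma card_realizable_vectors_ge: "n choose 2 \<le> card (realizable_vectors n)"
proof -
  have "(\<lambda>m. real m) ` {1..n choose 2} \<subseteq> fst ` realizable_vectors n"
  proof
    fix x assume "x \<in> (\<lambda>m. real m) ` {1..n choose 2}"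
    then obtain m where m: "x = real m" "m \<le> card (all_pairs {1..n})"
      by (auto simp: card_all_pairs)
    obtain E where E: "E \<subseteq> all_pairs {1..n}" "card E = m"
      using obtain_subset_with_card_n[OF m(2)] by metis
    show "x \<in> fst ` realizable_vectors n"
      by (rule rev_image_eqI[OF realizable_vectorsI[OF E(1)]]) (simp add: E(2) m(1))
  qed
  then have "card ((\<lambda>m. real m) ` {1..n choose 2}) \<le> card (fst ` realizable_vectors n)"
    by (intro card_mono) (simp_all add: finite_realizable_vectors)
  also have "\<dots> \<le> card (realizable_vectors n)"
    by (intro card_image_le finite_realizable_vectors)
  finally show ?thesis
    by (simp add: card_image)
qed

lemma card_noninterior_realizable_vectors_le:
  assumes "0 < n"
  shows "card (realizable_vectors n - rel_interior (model_polytope n)) \<le> 2 * n"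
proof -
  let ?q = "(0, 0) :: real \<times> real"
  let ?r = "(real (n choose 2), real (n - 1))"
  let ?K = "all_pairs {1..n}"
  have graph: "simple_graph ({1..n}, E)" if "E \<subseteq> ?K" for E
    using that by (simp add: simple_graph_iff)
  have ne: "{1..n} \<noteq> {}" using assms by simp
  have bottom: "degen ({1..n}, E) = 0 \<longleftrightarrow> E = {}"
    and top: "degen ({1..n}, E) = n - 1 \<longleftrightarrow> E = ?K"
    and le: "degen ({1..n}, E) \<le> n - 1" if "E \<subseteq> ?K" for E
    using degen_eq_0_iff[OF graph[OF that]] degen_eq_card_verts_minus_1_iff[OF graph[OF that]]
      degen_le[OF graph[OF that]] ne by auto
  have q: "?q \<in> realizable_vectors n"
    using realizable_vectorsI[of "{}" n] bottom[of "{}"] by simp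
  have r: "?r \<in> realizable_vectors n"
    using realizable_vectorsI[of ?K n] top[of ?K] by (simp add: card_all_pairs)
  have repr: "\<exists>E. E \<subseteq> ?K \<and> p = (real (card E), real (degen ({1..n}, E)))"
    if "p \<in> realizable_vectors n" for p
    using that by (auto simp: realizable_vectors_def labeled_graphs_eq num_edges_def)
  have between: "p = ?q \<or> p = ?r \<or> snd ?q < snd p \<and> snd p < snd ?r"
    if p: "p \<in> realizable_vectors n" for p
  proof -
    obtain E where E: "E \<subseteq> ?K" and pE: "p = (real (card E), real (degen ({1..n}, E)))"
      using repr[OF p] by blast
    consider "E = {}" | "E = ?K" | "degen ({1..n}, E) \<noteq> 0" "degen ({1..n}, E) \<noteq> n - 1"
      using bottom[OF E] top[OF E] by blast
    then show ?thesis
    proof cases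
      case 1
      then show ?thesis using pE bottom[OF E] by simp
    next
      case 2
      then show ?thesis using pE top[OF E] by (simp add: card_all_pairs)
    next
      case 3
      then have "0 < degen ({1..n}, E)" "degen ({1..n}, E) < n - 1"
        using le[OF E] by simp_all
      then show ?thesis using pE by (simp del: of_nat_diff)
    qed
  qed
  have "snd ` realizable_vectors n \<subseteq> real ` {..<n}"
  proof
    fix x assume "x \<in> snd ` realizable_vectors n"
    then obtain p where p: "p \<in> realizable_vectors n" "x = snd p"
      by (rule imageE)
    obtain E where "E \<subseteq> ?K" "p = (real (card E), real (degen ({1..n}, E)))"
      using repr[OF p(1)] by (elim exE conjE)
    with p(2) have "E \<subseteq> ?K" "x = real (degen ({1..n}, E))"
      by simp_all
    moreover from this assms have "degen ({1..n}, E) < n"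
      using le[of E] by linarith
    ultimately show "x \<in> real ` {..<n}"
      by (intro image_eqI[of _ _ "degen ({1..n}, E)"]) simp_all
  qed
  then have "card (snd ` realizable_vectors n) \<le> card (real ` {..<n})"
    by (intro card_mono) simp_all
  also have "\<dots> = n" by (simp add: card_image)
  finally show ?thesis
    using card_diff_rel_interior_convex_hull_le[OF finite_realizable_vectors q r between]
    by (simp add: model_polytope_def)
qed

theorem proposition3p4: "interior_proportion \<longlonglongrightarrow> 1"
proof (rule tendsto_sandwich)
  have bounds: "1 - 4 / (real n - 1) \<le> interior_proportion n \<and> interior_proportion n \<le> 1"
    if n: "2 \<le> n" for n
  proof -
    let ?R = "realizable_vectors n" and ?I = "rel_interior (model_polytope n)"
    have split: "real (card ?R) = real (card (?R \<inter> ?I)) + real (card (?R - ?I))"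
      by (metis card_Int_Diff finite_realizable_vectors of_nat_add)
    have few: "real (card (?R - ?I)) \<le> 2 * real n"
      using card_noninterior_realizable_vectors_le[of n] n by linarith
    have "real (n choose 2) = real n * (real n - 1) / 2"
      using n by (simp add: choose_two real_of_nat_div of_nat_diff)
    then have many: "real n * (real n - 1) / 2 \<le> real (card ?R)"
      using card_realizable_vectors_ge[of n] by linarith
    have pos: "0 < real n * (real n - 1) / 2"
      using n by simp
    have "real (card (?R - ?I)) / real (card ?R) \<le> 2 * real n / (real n * (real n - 1) / 2)"
      using few many pos by (intro frac_le) simp_all
    also have "\<dots> = 4 / (real n - 1)"
      using n by (simp add: field_simps)
    finally have "real (card (?R - ?I)) / real (card ?R) \<le> 4 / (real n - 1)" .
    moreover have "interior_proportion n = 1 - real (card (?R - ?I)) / real (card ?R)"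
      using split many pos by (simp add: interior_proportion_def field_simps)
    ultimately show ?thesis by simp
  qed
  show "\<forall>\<^sub>F n in sequentially. 1 - 4 / (real n - 1) \<le> interior_proportion n"
    and "\<forall>\<^sub>F n in sequentially. interior_proportion n \<le> 1"
    using bounds by (auto simp: eventually_sequentially)
  show "(\<lambda>n. 1 - 4 / (real n - 1)) \<longlonglongrightarrow> 1"
    by real_asymp
qed simp

end
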